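(* Let $\mathfrak{g}$ be an associative complex algebra with unit, equipped with a trace $\mathrm{Tr}\colon\mathfrak{g}\to\mathbb{C}$, i.e. a linear form with $\mathrm{Tr}(X\cdot Y)=\mathrm{Tr}(Y\cdot X)$ for all $X,Y\in\mathfrak{g}$. Then for all $F,G\in\mathcal{M}_a(\mathfrak{g})$, $$\mathrm{Tr}([F,G]_\times)=0.$$
   Context: $\mathcal{M}_a^0(\mathfrak{g})=\mathfrak{g}$ and, for $k\ge1$, $\mathcal{M}_a^k(\mathfrak{g})$ is the space of skew symmetric $k$-linear maps $\mathfrak{g}^k\to\mathfrak{g}$; $\mathcal{M}_a(\mathfrak{g})=\sum_{k\ge0}\mathcal{M}_a^k(\mathfrak{g})$. $\mathfrak{S}_{p,q}$ is the set of permutations $\sigma\in\mathfrak{S}_{p+q}$ with $\sigma(1)<\dots<\sigma(p)$ and $\sigma(p+1)<\dots<\sigma(p+q)$; $\varepsilon(\sigma)$ is the signature. The associative product $\times$ on $\mathcal{M}_a(\mathfrak{g})$ is defined, for $F\in\mathcal{M}_a^p(\mathfrak{g})$, $G\in\mathcal{M}_a^q(\mathfrak{g})$, by $$(F\times G)(Y_1,\dots,Y_{p+q})=\sum_{\sigma\in\mathfrak{S}_{p,q}}\varepsilon(\sigma)\,F(Y_{\sigma(1)},\dots,Y_{\sigma(p)})\cdot G(Y_{\sigma(p+1)},\dots,Y_{\sigma(p+q)}),$$ where $\cdot$ is the product of $\mathfrak{g}$. The super bracket is $[F,G]_\times=F\times G-(-1)^{pq}\,G\times F$ for $F\in\mathcal{M}_a^p(\mathfrak{g})$,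 $G\in\mathcal{M}_a^q(\mathfrak{g})$, extended bilinearly. $\bigwedge\mathfrak{g}$ denotes the algebra of skew symmetric multilinear forms on $\mathfrak{g}$. The trace is extended to a map $\mathrm{Tr}\colon\mathcal{M}_a(\mathfrak{g})\to\bigwedge\mathfrak{g}$ by $\mathrm{Tr}(F)(Y_1,\dots,Y_p)=\mathrm{Tr}(F(Y_1,\dots,Y_p))$ for $F\in\mathcal{M}_a^p(\mathfrak{g})$. *)

theory Defs
  imports Complex_Main "HOL-Combinatorics.Permutations"
begin

text \<open>
  The sort \<open>{ring, monoid_mult}\<close> is that of associative unital rings; unlike \<open>ring_1\<close>
  it does not exclude the zero ring.
\<close>

locale complex_unital_algebra =
  vector_space scale for scale :: "complex \<Rightarrow> 'a::{ring, monoid_mult} \<Rightarrow> 'a" +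
  assumes scale_mult_left: "scale c x * y = scale c (x * y)"
    and scale_mult_right: "x * scale c y = scale c (x * y)"

locale algebra_trace =
  complex_unital_algebra scale + Vector_Spaces.linear scale "(*)" Tr
  for scale :: "complex \<Rightarrow> 'a::{ring, monoid_mult} \<Rightarrow> 'a" and Tr :: "'a \<Rightarrow> complex" +
  assumes trace_commute: "Tr (x * y) = Tr (y * x)"

text \<open>
  A map of \<open>k\<close> arguments is encoded as a function of sequences \<open>Y :: nat \<Rightarrow> 'a\<close> that depends
  only on \<open>Y 0, \<dots>, Y (k - 1)\<close>; indices are thus shifted down by one. For \<open>k = 0\<close> these are
  the constant functions, i.e. the elements of the target. The target is a second
  complex vector space, with scalar multiplication \<open>scale'\<close>.
\<close>

definition skew_multilinear ::
  "(complex \<Rightarrow> 'a::ab_group_add \<Rightarrow> 'a) \<Rightarrow> (complex \<Rightarrow> 'b::ab_group_add \<Rightarrow> 'b) \<Rightarrow>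
    nat \<Rightarrow> ((nat \<Rightarrow> 'a) \<Rightarrow> 'b) set" where
  "skew_multilinear scale scale' k = {F.
     (\<forall>Y Z. (\<forall>i<k. Y i = Z i) \<longrightarrow> F Y = F Z) \<and>
     (\<forall>Y. \<forall>i<k. Vector_Spaces.linear scale scale' (\<lambda>x. F (Y(i := x)))) \<and>
     (\<forall>Y \<sigma>. \<sigma> permutes {..<k} \<longrightarrow> F (\<lambda>i. Y (\<sigma> i)) = scale' (of_int (sign \<sigma>)) (F Y))}"

text \<open>The direct sum over all degrees; \<open>F k\<close> is the component of degree \<open>k\<close> of \<open>F\<close>.\<close>

definition graded_skew_multilinear ::
  "(complex \<Rightarrow> 'a::ab_group_add \<Rightarrow> 'a) \<Rightarrow> (complex \<Rightarrow> 'b::ab_group_add \<Rightarrow> 'b) \<Rightarrow>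
    (nat \<Rightarrow> (nat \<Rightarrow> 'a) \<Rightarrow> 'b) set" where
  "graded_skew_multilinear scale scale' =
     {F. (\<forall>k. F k \<in> skew_multilinear scale scale' k) \<and> finite {k. F k \<noteq> (\<lambda>_. 0)}}"

definition skew_maps ::
  "(complex \<Rightarrow> 'a::ab_group_add \<Rightarrow> 'a) \<Rightarrow> (nat \<Rightarrow> (nat \<Rightarrow> 'a) \<Rightarrow> 'a) set" where
  "skew_maps scale = graded_skew_multilinear scale scale"

definition skew_forms ::
  "(complex \<Rightarrow> 'a::ab_group_add \<Rightarrow> 'a) \<Rightarrow> (nat \<Rightarrow> (nat \<Rightarrow> 'a) \<Rightarrow> complex) set" where
  "skew_forms scale = graded_skew_multilinear scale (*)"

definition shuffle_perms :: "nat \<Rightarrow> nat \<Rightarrow> (nat \<Rightarrow> nat) set" where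
  "shuffle_perms p q =
     {\<sigma>. \<sigma> permutes {..<p + q} \<and> strict_mono_on {..<p} \<sigma> \<and> strict_mono_on {p..<p + q} \<sigma>}"

text \<open>Product and super bracket of a map of degree \<open>p\<close> and a map of degree \<open>q\<close>.\<close>

definition hom_product ::
  "(complex \<Rightarrow> 'a::ring \<Rightarrow> 'a) \<Rightarrow> nat \<Rightarrow> nat \<Rightarrow>
    ((nat \<Rightarrow> 'a) \<Rightarrow> 'a) \<Rightarrow> ((nat \<Rightarrow> 'a) \<Rightarrow> 'a) \<Rightarrow> (nat \<Rightarrow> 'a) \<Rightarrow> 'a" where
  "hom_product scale p q F G Y =
     (\<Sum>\<sigma>\<in>shuffle_perms p q.
        scale (of_int (sign \<sigma>)) (F (\<lambda>i. Y (\<sigma> i)) * G (\<lambda>j. Y (\<sigma> (p + j)))))"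

definition hom_super_bracket ::
  "(complex \<Rightarrow> 'a::ring \<Rightarrow> 'a) \<Rightarrow> nat \<Rightarrow> nat \<Rightarrow>
    ((nat \<Rightarrow> 'a) \<Rightarrow> 'a) \<Rightarrow> ((nat \<Rightarrow> 'a) \<Rightarrow> 'a) \<Rightarrow> (nat \<Rightarrow> 'a) \<Rightarrow> 'a" where
  "hom_super_bracket scale p q F G Y =
     hom_product scale p q F G Y - scale ((-1) ^ (p * q)) (hom_product scale q p G F Y)"

text \<open>
  Bilinear extension: the component of degree \<open>n\<close> collects the brackets of all pairs of
  components whose degrees \<open>p\<close> and \<open>n - p\<close> add up to \<open>n\<close>.
\<close>

definition super_bracket ::
  "(complex \<Rightarrow> 'a::ring \<Rightarrow> 'a) \<Rightarrow> (nat \<Rightarrow> (nat \<Rightarrow> 'a) \<Rightarrow> 'a) \<Rightarrow>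
    (nat \<Rightarrow> (nat \<Rightarrow> 'a) \<Rightarrow> 'a) \<Rightarrow> nat \<Rightarrow> (nat \<Rightarrow> 'a) \<Rightarrow> 'a" where
  "super_bracket scale F G n Y =
     (\<Sum>p\<le>n. hom_super_bracket scale p (n - p) (F p) (G (n - p)) Y)"

definition trace_ext ::
  "('a \<Rightarrow> complex) \<Rightarrow> (nat \<Rightarrow> (nat \<Rightarrow> 'a) \<Rightarrow> 'a) \<Rightarrow> nat \<Rightarrow> (nat \<Rightarrow> 'a) \<Rightarrow> complex" where
  "trace_ext Tr F k Y = Tr (F k Y)"

lemma (in algebra_trace) trace_ext_in_skew_forms:
  assumes "F \<in> skew_maps scale"
  shows "trace_ext Tr F \<in> skew_forms scale"
proof -
  have F: "F k \<in> skew_multilinear scale scale k" for k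
    using assms by (simp add: skew_maps_def graded_skew_multilinear_def)
  have fin: "finite {k. F k \<noteq> (\<lambda>_. 0)}"
    using assms by (simp add: skew_maps_def graded_skew_multilinear_def)
  have "trace_ext Tr F k \<in> skew_multilinear scale (*) k" for k
  proof -
    have "Vector_Spaces.linear scale (*) (\<lambda>x. Tr (F k (Y(i := x))))" if "i < k" for Y i
    proof -
      have "Vector_Spaces.linear scale scale (\<lambda>x. F k (Y(i := x)))"
        using F[of k] that by (simp add: skew_multilinear_def)
      from Vector_Spaces.linear_compose[OF this linear_axioms]
      show ?thesis by (simp add: o_def)
    qed
    moreover have "F k Y = F k Z" if "\<forall>i<k. Y i = Z i" for Y Z
      using F[of k] that by (simp add: skew_multilinear_def)
    moreover have "Tr (F k (\<lambda>i. Y (\<sigma> i))) = of_int (sign \<sigma>) * Tr (F k Y)"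
      if "\<sigma> permutes {..<k}" for Y \<sigma>
      using F[of k] that by (simp add: skew_multilinear_def scale)
    ultimately show ?thesis
      unfolding skew_multilinear_def trace_ext_def by (auto intro: arg_cong[where f = Tr])
  qed
  moreover have "finite {k. trace_ext Tr F k \<noteq> (\<lambda>_. 0)}"
  proof (rule finite_subset[OF _ fin])
    show "{k. trace_ext Tr F k \<noteq> (\<lambda>_. 0)} \<subseteq> {k. F k \<noteq> (\<lambda>_. 0)}"
      unfolding trace_ext_def fun_eq_iff using zero by fastforce
  qed
  ultimately show ?thesis
    by (simp add: skew_forms_def graded_skew_multilinear_def)
qed

end

theory Submission
  imports Defs
begin

text \<open>
  Precomposition with the cyclic rotation by \<open>p\<close> positions, whose sign is
  \<open>(-1) ^ (p * q)\<close>, maps the \<open>(p, q)\<close>-shuffles bijectively onto the \<open>(q, p)\<close>-shuffles.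
  Together with the symmetry of the trace this matches the terms of \<open>Tr (F \<times> G)\<close> with
  those of \<open>(-1) ^ (p * q) Tr (G \<times> F)\<close> one by one.
\<close>

text \<open>Fixing all \<open>i\<close> \<ge> \<open>n\<close> makes this a permutation in the sense
  of \<open>permutes\<close>. Shifts are taken modulo \<open>n\<close>, so composing rotations adds
  their shifts.\<close>

definition rotation :: "nat \<Rightarrow> nat \<Rightarrow> nat \<Rightarrow> nat" where
  "rotation n k i = (if i < n then (i + k) mod n else i)"

lemma rotation_comp: "rotation n k \<circ> rotation n l = rotation n (k + l)"
  by (auto simp: rotation_def fun_eq_iff mod_simps ac_simps)

lemma rotation_0 [simp]: "rotation n 0 = id"
  by (auto simp: rotation_def)

lemma rotation_self [simp]: "rotation n n = id"
  by (auto simp: rotation_def)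

lemma rotation_add_left: "i < q \<Longrightarrow> rotation (p + q) p i = p + i"
  by (simp add: rotation_def add.commute)

lemma rotation_add_right: "i < p \<Longrightarrow> rotation (p + q) p (q + i) = i"
  by (simp add: rotation_def add.commute add.left_commute)

lemma permutes_rotation:
  assumes "k \<le> n"
  shows "rotation n k permutes {..<n}"
proof -
  \<comment> \<open>The inverse is the rotation by the complementary shift
    \<open>n - k\<close>.\<close>
  have "rotation n k \<circ> rotation n (n - k) = id" "rotation n (n - k) \<circ> rotation n k = id"
    using assms by (simp_all add: rotation_comp)
  then have "bij (rotation n k)"
    using o_bij by blast
  then show ?thesis
    by (simp add: permutes_def bij_iff rotation_def)
qed

text \<open>Splits one transposition off a long cycle, which gives the induction step for its
  sign.\<close>

lemma rotation_Suc_Suc_1: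
  "rotation (Suc (Suc n)) 1 = transpose 0 (Suc n) \<circ> rotation (Suc n) 1"
proof
  fix i
  consider "i < n" | "i = n" | "i = Suc n" | "i > Suc n"
    by linarith
  then show "rotation (Suc (Suc n)) 1 i = (transpose 0 (Suc n) \<circ> rotation (Suc n) 1) i"
    by cases (simp_all add: rotation_def transpose_def)
qed

lemma sign_rotation_1: "sign (rotation (Suc n) 1) = (-1) ^ n"
proof (induction n)
  case 0
  have "rotation 1 1 = id"
    by (rule rotation_self)
  then show ?case
    by simp
next
  case (Suc n)
  have "permutation (rotation (Suc n) 1)"
    using permutes_rotation[of 1 "Suc n"] by (auto intro: permutes_imp_permutation)
  then show ?case
    unfolding rotation_Suc_Suc_1
    using Suc by (subst sign_compose) (simp_all add: permutation_swap_id sign_swap_id)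
qed

text \<open>Rotation by \<open>k\<close> is the \<open>k\<close>-th power of the one-step rotation,
  a cycle of length \<open>Suc n\<close> and sign \<open>(-1) ^ n\<close>.\<close>

lemma sign_rotation: "k \<le> Suc n \<Longrightarrow> sign (rotation (Suc n) k) = (-1) ^ (k * n)"
proof (induction k)
  case (Suc k)
  have "permutation (rotation (Suc n) l)" if "l \<le> Suc n" for l
    using permutes_rotation[OF that] by (auto intro: permutes_imp_permutation)
  then have "sign (rotation (Suc n) 1 \<circ> rotation (Suc n) k) = (-1) ^ n * (-1) ^ (k * n)"
    using Suc by (subst sign_compose) (simp_all add: sign_rotation_1[unfolded One_nat_def])
  then show ?case
    by (simp add: rotation_comp power_add)
qed simp

lemma sign_rotation_add: "sign (rotation (p + q) p) = (-1) ^ (p * q)"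
proof (cases p)
  case (Suc m)
  have "sign (rotation (p + q) p) = (-1) ^ (p * (m + q))"
    using sign_rotation[of p "m + q"] Suc by simp
  \<comment> \<open>The term \<open>m * Suc m\<close> is a product of consecutive numbers, hence
    even, and drops out of the sign.\<close>
  also have "p * (m + q) = m * Suc m + p * q"
    by (simp add: Suc algebra_simps)
  finally show ?thesis
    by (simp add: power_add del: mult_Suc_right)
qed simp

text \<open>The rotation carries the first \<open>q\<close> indices in order onto the last
  \<open>q\<close>, and the last \<open>p\<close> onto the first \<open>p\<close>, so the two
  increasing blocks trade places.\<close>

lemma shuffle_perms_comp_rotation:
  assumes "\<sigma> \<in> shuffle_perms p q"
  shows "\<sigma> \<circ> rotation (p + q) p \<in> shuffle_perms q p"
proof -
  have \<sigma>: "\<sigma> permutes {..<p + q}" "strict_mono_on {..<p} \<sigma>" "strict_mono_on {p..<p + q} \<sigma>"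
    using assms by (auto simp: shuffle_perms_def)
  have "\<sigma> \<circ> rotation (p + q) p permutes {..<q + p}"
    using permutes_compose[OF permutes_rotation \<sigma>(1)] by (simp add: add.commute)
  moreover have "strict_mono_on {..<q} (\<sigma> \<circ> rotation (p + q) p)"
    using \<sigma>(3) by (auto simp: strict_mono_on_def rotation_add_left)
  moreover have "strict_mono_on {q..<q + p} (\<sigma> \<circ> rotation (p + q) p)"
  proof (rule strict_mono_onI)
    fix i j assume "i \<in> {q..<q + p}" "j \<in> {q..<q + p}" "i < j"
    then obtain i' j' where "i = q + i'" "j = q + j'" "i' < j'" "j' < p"
      by (metis add_less_cancel_left atLeastLessThan_iff le_Suc_ex)
    then show "(\<sigma> \<circ> rotation (p + q) p) i < (\<sigma> \<circ> rotation (p + q) p) j"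
      using \<sigma>(2) by (simp add: strict_mono_on_def rotation_add_right)
  qed
  ultimately show ?thesis
    by (simp add: shuffle_perms_def)
qed

text \<open>The rotations by \<open>p\<close> and by \<open>q\<close> are mutually inverse, since
  their shifts add up to \<open>p + q\<close>.\<close>

lemma bij_betw_shuffle_perms_rotation:
  "bij_betw (\<lambda>\<sigma>. \<sigma> \<circ> rotation (p + q) p) (shuffle_perms p q) (shuffle_perms q p)"
  using shuffle_perms_comp_rotation[of _ p q] shuffle_perms_comp_rotation[of _ q p]
  by (intro bij_betw_byWitness[where f' = "\<lambda>\<sigma>. \<sigma> \<circ> rotation (q + p) q"])
    (auto simp: comp_assoc rotation_comp add.commute)

context algebra_trace
begin

lemma trace_hom_product:
  "Tr (hom_product scale p q F G Y) =
     (\<Sum>\<sigma>\<in>shuffle_perms p q. of_int (sign \<sigma>) * Tr (F (\<lambda>i. Y (\<sigma> i)) * G (\<lambda>j. Y (\<sigma> (p + j)))))"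
  by (simp add: hom_product_def sum scale)

lemma trace_hom_product_commute:
  assumes F: "\<And>Y Z. (\<forall>i<p. Y i = Z i) \<Longrightarrow> F Y = F Z"
    and G: "\<And>Y Z. (\<forall>i<q. Y i = Z i) \<Longrightarrow> G Y = G Z"
  shows "Tr (hom_product scale p q F G Y) = (-1) ^ (p * q) * Tr (hom_product scale q p G F Y)"
proof -
  let ?\<rho> = "rotation (p + q) p"
  have "of_int (sign \<sigma>) * Tr (F (\<lambda>i. Y (\<sigma> i)) * G (\<lambda>j. Y (\<sigma> (p + j)))) =
      (-1) ^ (p * q) * (of_int (sign (\<sigma> \<circ> ?\<rho>)) *
        Tr (G (\<lambda>j. Y ((\<sigma> \<circ> ?\<rho>) j)) * F (\<lambda>i. Y ((\<sigma> \<circ> ?\<rho>) (q + i)))))"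
    if "\<sigma> \<in> shuffle_perms p q" for \<sigma>
  proof -
    have "\<sigma> permutes {..<p + q}"
      using that by (simp add: shuffle_perms_def)
    then have "sign (\<sigma> \<circ> ?\<rho>) = sign \<sigma> * (-1) ^ (p * q)"
      using permutes_rotation[of p "p + q"]
      by (subst sign_compose) (auto simp: sign_rotation_add intro: permutes_imp_permutation)
    \<comment> \<open>The two sequences need agree only below \<open>p\<close>, so the locality of
      \<open>F\<close> is required; likewise for \<open>G\<close> below \<open>q\<close>.\<close>
    moreover have "F (\<lambda>i. Y (\<sigma> i)) = F (\<lambda>i. Y ((\<sigma> \<circ> ?\<rho>) (q + i)))"
      by (rule F) (simp add: rotation_add_right)
    moreover have "G (\<lambda>j. Y (\<sigma> (p + j))) = G (\<lambda>j. Y ((\<sigma> \<circ> ?\<rho>) j))"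
      by (rule G) (simp add: rotation_add_left)
    ultimately show ?thesis
      \<comment> \<open>The sign of the rotation cancels against the prefactor, both being
        \<open>(-1) ^ (p * q)\<close>.\<close>
      by (simp add: trace_commute minus_one_power_iff)
  qed
  then show ?thesis
    unfolding trace_hom_product sum_distrib_left
      sum.reindex_bij_betw[OF bij_betw_shuffle_perms_rotation, of _ p q, symmetric]
    by (rule sum.cong[OF refl])
qed

end

theorem corollary4p3p5:
  fixes scale :: "complex \<Rightarrow> 'a::{ring, monoid_mult} \<Rightarrow> 'a"
    and Tr :: "'a \<Rightarrow> complex"
    and F G :: "nat \<Rightarrow> (nat \<Rightarrow> 'a) \<Rightarrow> 'a"
  assumes "algebra_trace scale Tr"
    and "F \<in> skew_maps scale"
    and "G \<in> skew_maps scale"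
  shows "trace_ext Tr (super_bracket scale F G) = (\<lambda>n Y. 0)"
proof -
  interpret algebra_trace scale Tr
    by fact
  have local: "H k Y = H k Z" if "H \<in> skew_maps scale" "\<forall>i<k. Y i = Z i" for H k Y Z
    using that unfolding skew_maps_def graded_skew_multilinear_def skew_multilinear_def by blast
  \<comment> \<open>Homogeneous components suffice: \<open>Tr\<close> is linear and each degree of
    the bracket is a finite sum over such pairs.\<close>
  have "Tr (hom_super_bracket scale p q (F p) (G q) Y) = 0" for p q Y
    using trace_hom_product_commute[of p "F p" q "G q" Y] local[OF assms(2)] local[OF assms(3)]
    by (simp add: hom_super_bracket_def diff scale)
  then show ?thesis
    by (simp add: fun_eq_iff trace_ext_def super_bracket_def sum)
qed

end
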